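(* For every $k \geq 3$ and any $\delta > 0$, any deterministic anonymous strategyproof mechanism for $(\sqrt{2}-\delta)$-stable instances of $k$-Facility Location on the real line with $n \geq k+1$ agents has an unbounded approximation ratio; i.e., there is no $\rho$ (depending only on $n$ and $k$) such that the mechanism's social cost is at most $\rho$ times the optimal social cost on every $(\sqrt{2}-\delta)$-stable instance.
   Context: Agents $1,\ldots,n$ have private locations $\vec{x}=(x_1,\ldots,x_n)\in\mathbb{R}^n$; $d(x,y)=|x-y|$. A deterministic mechanism $M$ maps each instance to $k$ facility locations $M(\vec{x})\in\mathbb{R}^k$; agent $i$'s cost is $d(x_i,M(\vec{x}))=\min_l |x_i-M_l(\vec{x})|$ and the social cost is $\sum_i d(x_i,M(\vec{x}))$; the optimal social cost is $\min_{\vec{c}\in\mathbb{R}^k}\sum_i\min_l|x_i-c_l|$. $M$ is anonymous if its output depends only on the multiset of locations, not on agent identities. $M$ is strategyproof for $\gamma$-stable instances if for every $\gamma$-stable $\vec{x}$, every agent $i$ and every $y$ such that $(\vec{x}_{-i},y)$ (i.e. $\vec{x}$ with $x_i$ replaced by $y$) is $\gamma$-stable, $d(x_i,M(\vec{x}))\le d(x_i,M(\vec{x}_{-i},y))$. A clustering partitions the sorted locations into $k$ sets of consecutive locations; the optimal clustering is induced (nearest-facility assignment) by an optimal facility profile. A $\gamma$-perturbation of a sorted profile $\vec{x}$ ($\gamma\ge1$) is a sorted profile $\vec{x}'$ with $x'_1=x_1$ and $d(x_i,x_{i+1})/\gamma\le d(x'_i,x'_{i+1})\le d(x_i,x_{i+1})$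 for all $i\in[n-1]$; $\vec{x}$ is $\gamma$-stable if it has a unique optimal clustering and every $\gamma$-perturbation has the same unique optimal clustering (same cluster sizes in the same order). *)

theory Defs
  imports Complex_Main "HOL-Library.Multiset"
begin

text \<open>Profiles of agent locations are lists of reals (agent i at position i, 0-based);
  facility profiles are lists of reals of length k.\<close>

definition dist_fac :: "real \<Rightarrow> real list \<Rightarrow> real" where
  "dist_fac p c = Min ((\<lambda>l. \<bar>p - l\<bar>) ` set c)"

definition social_cost :: "real list \<Rightarrow> real list \<Rightarrow> real" where
  "social_cost x c = (\<Sum>i<length x. dist_fac (x ! i) c)"

definition optimal_profile :: "nat \<Rightarrow> real list \<Rightarrow> real list \<Rightarrow> bool" where
  "optimal_profile k x c \<longleftrightarrow> length c = k \<and>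
     (\<forall>c'. length c' = k \<longrightarrow> social_cost x c \<le> social_cost x c')"

definition opt_cost :: "nat \<Rightarrow> real list \<Rightarrow> real" where
  "opt_cost k x = Inf {social_cost x c | c. length c = k}"

text \<open>A clustering of a sorted profile of n locations into k sets of consecutive
  locations, given by the list of cluster sizes (in order, all nonempty).
  Cluster j consists of the (sorted) indices in [s_0+..+s_(j-1), s_0+..+s_j).\<close>
definition is_clustering :: "nat \<Rightarrow> nat \<Rightarrow> nat list \<Rightarrow> bool" where
  "is_clustering k n s \<longleftrightarrow> length s = k \<and> (\<forall>j<k. s ! j > 0) \<and> sum_list s = n"

definition in_cluster :: "nat list \<Rightarrow> nat \<Rightarrow> nat \<Rightarrow> bool" where
  "in_cluster s j i \<longleftrightarrow> sum_list (take j s) \<le> i \<and> i < sum_list (take (Suc j) s)"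

definition induced_by :: "real list \<Rightarrow> nat list \<Rightarrow> real list \<Rightarrow> bool" where
  "induced_by x s c \<longleftrightarrow> length c = length s \<and>
     (\<forall>j<length s. \<forall>i<length x. in_cluster s j i \<longrightarrow> \<bar>x ! i - c ! j\<bar> = dist_fac (x ! i) c)"

definition optimal_clustering :: "nat \<Rightarrow> real list \<Rightarrow> nat list \<Rightarrow> bool" where
  "optimal_clustering k x s \<longleftrightarrow> is_clustering k (length x) s \<and>
     (\<exists>c. optimal_profile k x c \<and> induced_by x s c)"

definition perturbation :: "real \<Rightarrow> real list \<Rightarrow> real list \<Rightarrow> bool" where
  "perturbation \<gamma> x x' \<longleftrightarrow> sorted x' \<and> length x' = length x \<and> x' ! 0 = x ! 0 \<and>
     (\<forall>i. Suc i < length x \<longrightarrow>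
        \<bar>x ! i - x ! Suc i\<bar> / \<gamma> \<le> \<bar>x' ! i - x' ! Suc i\<bar> \<and>
        \<bar>x' ! i - x' ! Suc i\<bar> \<le> \<bar>x ! i - x ! Suc i\<bar>)"

definition stable_sorted :: "real \<Rightarrow> nat \<Rightarrow> real list \<Rightarrow> bool" where
  "stable_sorted \<gamma> k x \<longleftrightarrow>
     (\<exists>!s. optimal_clustering k x s) \<and>
     (\<forall>x'. perturbation \<gamma> x x' \<longrightarrow>
        (\<exists>!s'. optimal_clustering k x' s') \<and>
        (THE s'. optimal_clustering k x' s') = (THE s. optimal_clustering k x s))"

definition stable :: "real \<Rightarrow> nat \<Rightarrow> real list \<Rightarrow> bool" where
  "stable \<gamma> k x \<longleftrightarrow> stable_sorted \<gamma> k (sort x)"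

definition anonymous :: "nat \<Rightarrow> (real list \<Rightarrow> real list) \<Rightarrow> bool" where
  "anonymous n M \<longleftrightarrow> (\<forall>x y. length x = n \<and> length y = n \<and> mset x = mset y \<longrightarrow> M x = M y)"

definition strategyproof_stable ::
    "nat \<Rightarrow> nat \<Rightarrow> real \<Rightarrow> (real list \<Rightarrow> real list) \<Rightarrow> bool" where
  "strategyproof_stable n k \<gamma> M \<longleftrightarrow>
     (\<forall>x i y. length x = n \<and> i < n \<and> stable \<gamma> k x \<and> stable \<gamma> k (x[i := y]) \<longrightarrow>
        dist_fac (x ! i) (M x) \<le> dist_fac (x ! i) (M (x[i := y])))"

end

theory Submission
  imports Defs
begin

text \<open>All agents except two are kept fixed: \<open>n - k\<close> agents at \<open>0\<close> and one agent at each of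
  \<open>1, 3, 5, \<dots>\<close>. The remaining two agents at \<open>a\<close> and \<open>b\<close> stay far to the right. The instance is
  stable if \<open>\<bar>a - b\<bar> < 1 / \<gamma>\<close> (then \<open>a, b\<close> share a cluster) or \<open>\<bar>a - b\<bar> > \<gamma>\<close> (then \<open>0\<close> and
  \<open>1\<close> share a cluster). When \<open>\<bar>a - b\<bar>\<close> is tiny, a bounded ratio leaves a single facility for the
  two agents, located between them.

  If the right agent of every tiny pair is not served exactly, fix \<open>a\<close> and consider the set of all
  facilities that the other agent can obtain. By strategyproofness that agent always receives a
  nearest point of this set, and the set has a hole \<open>(a, r)\<close> to the right of \<open>a\<close>. Placing the agent
  at \<open>w\<close> just below \<open>r\<close> yields a facility at \<open>r\<close>; moving the agent at \<open>a\<close> to \<open>r\<close> keeps it there, so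
  the right agent of the tiny pair \<open>(w, r)\<close> is served, a contradiction. Since \<open>\<gamma>\<^sup>2 < 2\<close>, an endpoint
  \<open>r\<close> in the unstable range \<open>[a + 1 / \<gamma>, a + \<gamma>]\<close> is still reached from \<open>w\<close> just below
  \<open>a + 1 / \<gamma>\<close>, and the hole to the right of \<open>w\<close> then ends in the stable range. The mirrored
  argument excludes that all left agents are unserved. Finally, one tiny pair with an
  unserved right agent forces the same for all tiny pairs further to the right, so one of the two
  situations must occur.\<close>

subsection \<open>Holes in the set of obtainable facilities\<close>

lemma abs_minus_add_cancel: "\<bar>- x - y\<bar> = \<bar>x + y\<bar>" for x y :: real
  by linarith

text \<open>Read \<open>N v\<close> as the facilities resulting from the report \<open>v\<close>.
  The endpoint \<open>r\<close> is the infimum of all obtainable facilities to the right of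
  \<open>v0\<close>; strategyproofness at the unserved \<open>v0\<close> keeps them at a positive
  distance. An agent at \<open>w\<close> gets a facility no farther away than \<open>r - w\<close>,
  hence in \<open>(v0, r]\<close>, and minimality of \<open>r\<close> makes it \<open>r\<close>
  itself.\<close>

lemma hole_right:
  fixes N :: "real \<Rightarrow> real set" and V :: "real set"
  assumes sp: "\<And>v w. v \<in> V \<Longrightarrow> w \<in> V \<Longrightarrow> \<exists>m\<in>N v. \<forall>m'\<in>N w. \<bar>v - m\<bar> \<le> \<bar>v - m'\<bar>"
    and v0: "v0 \<in> V" "v0 \<notin> N v0" and v1: "v1 \<in> V" "i \<in> N v1" "v0 < i"
  obtains r where "v0 < r" "r \<le> i"
    "\<And>w. w \<in> V \<Longrightarrow> w \<le> r \<Longrightarrow> r - w < w - v0 \<Longrightarrow> r \<in> N w"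
proof -
  define S where "S = {j. v0 < j \<and> (\<exists>w\<in>V. j \<in> N w)}"
  have iS: "i \<in> S" using v1 by (auto simp: S_def)
  have bdd: "bdd_below S" by (intro bdd_belowI[of _ v0]) (auto simp: S_def)
  define D where "D = Inf S"
  have D_le: "D \<le> j" if "j \<in> S" for j
    unfolding D_def using that bdd by (rule cInf_lower)
  have "\<exists>d>0. \<forall>j\<in>S. v0 + d \<le> j"
  proof -
    \<comment> \<open>The distance from \<open>v0\<close> to its own nearest facility works:
      anything obtainable and nearer would be a profitable deviation.\<close>
    have "\<exists>d>0. \<forall>w\<in>V. \<forall>j\<in>N w. d \<le> \<bar>v0 - j\<bar>"
    proof (rule ccontr)
      assume neg: "\<not> ?thesis"
      obtain p where p: "p \<in> N v0" "\<forall>m'\<in>N v0. \<bar>v0 - p\<bar> \<le> \<bar>v0 - m'\<bar>"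
        using sp[OF v0(1) v0(1)] by blast
      have "\<bar>v0 - p\<bar> > 0" using p(1) v0(2) by auto
      then obtain w j where "w \<in> V" "j \<in> N w" "\<bar>v0 - j\<bar> < \<bar>v0 - p\<bar>"
        using neg by (meson not_le)
      then show False using sp[OF v0(1)] p(2) by fastforce
    qed
    then show ?thesis unfolding S_def by fastforce
  qed
  then obtain d where d: "d > 0" "\<forall>j\<in>S. v0 + d \<le> j" by blast
  have "v0 + d \<le> D" unfolding D_def using iS d(2) by (intro cInf_greatest) auto
  then have gt: "v0 < D" using d(1) by linarith
  have "D \<in> N w" if w: "w \<in> V" "w \<le> D" "D - w < w - v0" for w
  proof -
    obtain m where m: "m \<in> N w" "\<forall>m'\<in>N w. \<bar>w - m\<bar> \<le> \<bar>w - m'\<bar>"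
      using sp[OF w(1) w(1)] by blast
    have best: "\<bar>w - m\<bar> \<le> j - w" if jS: "j \<in> S" for j
    proof -
      obtain w' where "w' \<in> V" "j \<in> N w'" using jS by (auto simp: S_def)
      then obtain m'' where "m'' \<in> N w" "\<bar>w - m''\<bar> \<le> \<bar>w - j\<bar>" using sp[OF w(1)] by blast
      then show ?thesis using m(2) D_le[OF jS] w(2) by force
    qed
    \<comment> \<open>The bounds \<open>best\<close> pass to the infimum; together with
      \<open>D - w < w - v0\<close> they force \<open>m\<close> into \<open>(v0, D]\<close>.\<close>
    have "w + \<bar>w - m\<bar> \<le> D"
      unfolding D_def using iS best by (intro cInf_greatest) (auto simp: algebra_simps)
    then have *: "v0 < m" "m \<le> D" using w by linarith+
    then have "m \<in> S" using m(1) w(1) by (auto simp: S_def)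
    then have "m = D" using D_le * by force
    then show ?thesis using m(1) by simp
  qed
  with gt D_le[OF iS] show thesis using that by blast
qed

text \<open>This is \<open>hole_right\<close> reflected at the origin.\<close>

lemma hole_left:
  fixes N :: "real \<Rightarrow> real set" and V :: "real set"
  assumes sp: "\<And>v w. v \<in> V \<Longrightarrow> w \<in> V \<Longrightarrow> \<exists>m\<in>N v. \<forall>m'\<in>N w. \<bar>v - m\<bar> \<le> \<bar>v - m'\<bar>"
    and v0: "v0 \<in> V" "v0 \<notin> N v0" and v1: "v1 \<in> V" "i \<in> N v1" "i < v0"
  obtains l where "l < v0" "i \<le> l"
    "\<And>w. w \<in> V \<Longrightarrow> l \<le> w \<Longrightarrow> w - l < v0 - w \<Longrightarrow> l \<in> N w"
proof (rule hole_right[of "uminus ` V" "\<lambda>v. uminus ` N (- v)" "- v0" "- v1" "- i"])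
  fix v w assume "v \<in> uminus ` V" "w \<in> uminus ` V"
  then have "\<exists>m\<in>N (- v). \<forall>m'\<in>N (- w). \<bar>- v - m\<bar> \<le> \<bar>- v - m'\<bar>"
    by (intro sp) auto
  then show "\<exists>m\<in>uminus ` N (- v). \<forall>m'\<in>uminus ` N (- w). \<bar>v - m\<bar> \<le> \<bar>v - m'\<bar>"
    unfolding bex_simps(7) ball_simps(9) by (simp add: abs_minus_add_cancel)
next
  fix r assume r: "- v0 < r" "r \<le> - i"
    "\<And>w. w \<in> uminus ` V \<Longrightarrow> w \<le> r \<Longrightarrow> r - w < w - - v0 \<Longrightarrow> r \<in> uminus ` N (- w)"
  show thesis
  proof (rule that[of "- r"])
    fix w assume "w \<in> V" "- r \<le> w" "w - - r < v0 - w"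
    then show "- r \<in> N w" using r(3)[of "- w"] by (auto simp: image_iff)
  qed (use r in auto)
qed (use v0 v1 in auto)

section \<open>The game of the two free agents\<close>

text \<open>These are the distances that will guarantee stability: below \<open>1 / \<gamma>\<close>
  the pair forms the smallest gap, above \<open>\<gamma>\<close> the gap of length 1 at the left end
  does, in both cases by a factor exceeding \<open>\<gamma>\<close>.\<close>

definition separated :: "real \<Rightarrow> real \<Rightarrow> real \<Rightarrow> bool" where
  "separated \<gamma> a b \<longleftrightarrow> \<bar>a - b\<bar> < 1 / \<gamma> \<or> \<gamma> < \<bar>a - b\<bar>"

text \<open>The set \<open>N a b\<close> stays abstract so that the mirrored statement follows by
  substitution. \<open>\<tau>\<close> bounds the width of a tiny pair, and \<open>big\<close> leaves
  room for a distant agent together with a facility within \<open>\<rho>\<close> of it.\<close>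

lemma right_agent_served:
  fixes N :: "real \<Rightarrow> real \<Rightarrow> real set" and \<gamma> \<rho> \<tau> lo hi :: real
  assumes \<gamma>: "1 \<le> \<gamma>" "\<gamma> * \<gamma> < 2" and \<rho>: "0 \<le> \<rho>" and \<tau>: "0 < \<tau>"
    and sym: "\<And>a b. N a b = N b a"
    and sp: "\<And>a v w. a \<in> {lo..hi} \<Longrightarrow> v \<in> {lo..hi} \<Longrightarrow> w \<in> {lo..hi} \<Longrightarrow>
      separated \<gamma> a v \<Longrightarrow> separated \<gamma> a w \<Longrightarrow>
      \<exists>m\<in>N a v. \<forall>m'\<in>N a w. \<bar>v - m\<bar> \<le> \<bar>v - m'\<bar>"
    and far: "\<And>a b. a \<in> {lo..hi} \<Longrightarrow> b \<in> {lo..hi} \<Longrightarrow> \<gamma> < \<bar>a - b\<bar> \<Longrightarrow> \<exists>m\<in>N a b. \<bar>b - m\<bar> \<le> \<rho>"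
    and big: "lo + \<gamma> + 2 * \<rho> + \<tau> + 1 \<le> hi"
  shows "\<exists>a b. lo \<le> a \<and> a < b \<and> b \<le> a + \<tau> \<and> b \<le> hi \<and> b \<in> N a b"
proof (rule ccontr)
  assume neg: "\<not> ?thesis"
  have P: "b \<notin> N a b" if "lo \<le> a" "a < b" "b \<le> a + \<tau>" "b \<le> hi" for a b
    using neg that by blast
  have g0: "0 < 1 / \<gamma>" "0 < \<gamma>" using \<gamma> by auto
  have "1 / \<gamma> \<le> 1" using \<gamma> by simp
  then have g1: "1 / \<gamma> \<le> \<gamma>" using \<gamma> by linarith
  \<comment> \<open>Here \<open>\<gamma> * \<gamma> < 2\<close> enters: two steps shorter than
    \<open>1 / \<gamma>\<close> can cross the unstable range.\<close>
  have g2: "\<gamma> < 1 / \<gamma> + 1 / \<gamma>" using \<gamma> by (simp add: field_simps)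
  \<comment> \<open>With the agent at \<open>w\<close> fixed, the report \<open>a\<close> produces a
    facility at \<open>r\<close>, so an agent located at \<open>r\<close> must be served at distance
    0.\<close>
  have absorb: "r \<in> N w r" if "a \<in> {lo..hi}" "w \<in> {lo..hi}" "r \<in> {lo..hi}"
      "separated \<gamma> a w" "separated \<gamma> w r" "r \<in> N a w" for a w r
  proof -
    have "\<exists>m\<in>N w r. \<forall>m'\<in>N w a. \<bar>r - m\<bar> \<le> \<bar>r - m'\<bar>"
      using that by (intro sp) (auto simp: separated_def abs_minus_commute)
    moreover have "r \<in> N w a" using that(6) sym by simp
    ultimately show ?thesis by fastforce
  qed
  \<comment> \<open>A facility obtainable at most \<open>1 / \<gamma>\<close> to the right of
    \<open>a\<close> bounds a hole ending at some \<open>r\<close>; a tiny pair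
    \<open>(w, r)\<close> at this end would have its right agent served.\<close>
  have close: False if a: "lo \<le> a" and r': "a < r'" "r' \<le> a + 1 / \<gamma>" "r' \<le> hi"
      and w': "w' \<in> {lo..hi}" "separated \<gamma> a w'" "r' \<in> N a w'" for a r' w'
  proof -
    \<comment> \<open>The cap \<open>\<tau>\<close> makes \<open>(a, v0)\<close> tiny, so
      \<open>P\<close> leaves \<open>v0\<close> unserved; halving keeps \<open>v0\<close> below
      \<open>r'\<close>.\<close>
    define v0 where "v0 = a + min \<tau> ((r' - a) / 2)"
    have v0: "a < v0" "v0 \<le> a + \<tau>" "v0 < r'" using \<tau> r' by (auto simp: v0_def min_def field_simps)
    have v0V: "separated \<gamma> a v0" using v0 r' by (auto simp: separated_def)
    obtain r where r: "v0 < r" "r \<le> r'" and rN: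
      "\<And>w. w \<in> {v \<in> {lo..hi}. separated \<gamma> a v} \<Longrightarrow> w \<le> r \<Longrightarrow> r - w < w - v0 \<Longrightarrow> r \<in> N a w"
    proof (rule hole_right[of "{v \<in> {lo..hi}. separated \<gamma> a v}" "N a" v0 w' r'])
      show "v0 \<notin> N a v0" using P a v0 r' by auto
    qed (use sp a r' v0 v0V w' in auto)
    \<comment> \<open>A third of the hole keeps \<open>w\<close> nearer to \<open>r\<close> than to
      \<open>v0\<close>; the cap makes \<open>(w, r)\<close> tiny.\<close>
    define w where "w = r - min \<tau> ((r - v0) / 3)"
    have w: "w < r" "r \<le> w + \<tau>" "r - w < w - v0" "v0 < w"
      using \<tau> r by (auto simp: w_def min_def field_simps)
    have aw: "separated \<gamma> a w" "separated \<gamma> w r" using w v0 r r' by (auto simp: separated_def)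
    have "r \<in> N w r"
      using rN[of w] aw w v0 r r' a by (intro absorb[of a]) auto
    then show False using P[of w r] w r r' a v0 by auto
  qed
  \<comment> \<open>In the middle case below, \<open>r - w\<close> is at most
    \<open>\<gamma> - 1 / \<gamma> + e\<close> and \<open>w - v0\<close> equals
    \<open>1 / \<gamma> - 2 * e\<close>, so \<open>3 * e\<close> must stay below
    \<open>2 / \<gamma> - \<gamma>\<close>.\<close>
  define e where "e = min \<tau> ((1 / \<gamma> + 1 / \<gamma> - \<gamma>) / 4)"
  have e: "0 < e" "e \<le> \<tau>" "4 * e \<le> 1 / \<gamma> + 1 / \<gamma> - \<gamma>"
    using \<tau> g2 by (auto simp: e_def min_def)
  have e1: "4 * e \<le> 1 / \<gamma>" using e g1 by linarith
  define v0 where "v0 = lo + e"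
  have lohi: "lo + \<tau> < hi" "lo + \<gamma> < hi - \<rho>" "lo \<le> hi" using big \<rho> \<tau> g0 by linarith+
  \<comment> \<open>The margin \<open>\<rho>\<close> guarantees that this facility, and hence the
    end of the hole, does not exceed \<open>hi\<close>.\<close>
  obtain i where i: "i \<in> N lo (hi - \<rho>)" "\<bar>hi - \<rho> - i\<bar> \<le> \<rho>"
    using far[of lo "hi - \<rho>"] lohi \<rho> g0 by auto
  have ib: "v0 < i" "i \<le> hi" using i(2) big e g0 by (auto simp: v0_def)
  have v0V: "separated \<gamma> lo v0" using e e1 by (auto simp: separated_def v0_def)
  obtain r where r: "v0 < r" "r \<le> i" and rN:
    "\<And>w. w \<in> {v \<in> {lo..hi}. separated \<gamma> lo v} \<Longrightarrow> w \<le> r \<Longrightarrow> r - w < w - v0 \<Longrightarrow> r \<in> N lo w"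
  proof (rule hole_right[of "{v \<in> {lo..hi}. separated \<gamma> lo v}" "N lo" v0 "hi - \<rho>" i])
    show "v0 \<notin> N lo v0" using P[of lo v0] e lohi by (auto simp: v0_def)
    show "hi - \<rho> \<in> {v \<in> {lo..hi}. separated \<gamma> lo v}"
      using lohi \<rho> g0 by (auto simp: separated_def)
  qed (use sp lohi e v0V i ib in \<open>auto simp: v0_def\<close>)
  have rhi: "r \<le> hi" using r ib by linarith
  consider "r \<le> lo + 1 / \<gamma>" | "lo + 1 / \<gamma> < r" "r \<le> lo + \<gamma>" | "lo + \<gamma> < r" by linarith
  then show False
  proof cases
    case 1
    define w where "w = r - (r - v0) / 3"
    have w: "w < r" "r - w < w - v0" "v0 < w" using r by (auto simp: w_def field_simps)
    have "r \<in> N lo w" "separated \<gamma> lo w"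
      using rN[of w] w r rhi 1 e by (auto simp: v0_def separated_def)
    then show False using close[of lo r w] w r rhi 1 e by (auto simp: v0_def)
  next
    case 2
    \<comment> \<open>The pair \<open>lo\<close>, \<open>r\<close> may be unstable, but this
      \<open>w\<close> is stable with both. It reaches \<open>r\<close>, and \<open>close\<close>
      then applies with \<open>w\<close> as the fixed agent.\<close>
    define w where "w = lo + 1 / \<gamma> - e"
    have w: "w < r" "r - w < w - v0" "v0 < w" "r < w + 1 / \<gamma>"
      using 2 e e1 by (auto simp: w_def v0_def)
    have lw: "separated \<gamma> lo w" "separated \<gamma> w r" using w e e1 by (auto simp: separated_def w_def)
    have wD: "w \<in> {lo..hi}" "r \<in> {lo..hi}" using w rhi e by (auto simp: v0_def)
    have "r \<in> N w r" using rN[of w] lw w wD lohi by (intro absorb[of lo]) auto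
    then show False using close[of w r r] w lw wD by auto
  next
    case 3
    \<comment> \<open>The shift \<open>d\<close> below \<open>r\<close> must keep \<open>w\<close>
      nearer to \<open>r\<close> than to \<open>v0\<close> (\<open>A\<close>), beyond
      \<open>lo + \<gamma>\<close> (\<open>B\<close>) and within \<open>1 / \<gamma>\<close> of
      \<open>r\<close> (\<open>C\<close>); \<open>\<tau>\<close> makes \<open>(w, r)\<close>
      tiny.\<close>
    define A B C where "A = (r - v0) / 3" and "B = (r - lo - \<gamma>) / 2" and "C = (1 / \<gamma>) / 2"
    have "0 < A" "0 < B" "0 < C" using 3 g0 r by (auto simp: A_def B_def C_def)
    moreover have ABC: "3 * A = r - v0" "2 * B = r - lo - \<gamma>" "2 * C = 1 / \<gamma>"
      by (auto simp: A_def B_def C_def)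
    ultimately have "\<exists>d>0. d \<le> \<tau> \<and> d \<le> A \<and> d \<le> B \<and> d \<le> C"
      using \<tau> by (intro exI[of _ "min \<tau> (min A (min B C))"]) (simp add: min_le_iff_disj)
    then obtain d where "0 < d" "d \<le> \<tau>" "d \<le> A" "d \<le> B" "d \<le> C" by blast
    moreover define w where "w = r - d"
    ultimately have w: "w < r" "r - w < w - v0" "v0 < w" "r \<le> w + \<tau>" "r < w + 1 / \<gamma>" "lo + \<gamma> < w"
      using 3 g0 r ABC by linarith+
    have lw: "separated \<gamma> lo w" "separated \<gamma> w r" using w e e1 by (auto simp: separated_def)
    have wD: "w \<in> {lo..hi}" "r \<in> {lo..hi}" using w rhi e by (auto simp: v0_def)
    have "r \<in> N w r" using rN[of w] lw w wD lohi by (intro absorb[of lo]) auto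
    then show False using P[of w r] w lw wD by auto
  qed
qed

text \<open>Reflection turns left agents into right agents, and symmetry of \<open>N\<close>
  restores the order of the arguments.\<close>

lemma left_agent_served:
  fixes N :: "real \<Rightarrow> real \<Rightarrow> real set" and \<gamma> \<rho> \<tau> lo hi :: real
  assumes \<gamma>: "1 \<le> \<gamma>" "\<gamma> * \<gamma> < 2" and \<rho>: "0 \<le> \<rho>" and \<tau>: "0 < \<tau>"
    and sym: "\<And>a b. N a b = N b a"
    and sp: "\<And>a v w. a \<in> {lo..hi} \<Longrightarrow> v \<in> {lo..hi} \<Longrightarrow> w \<in> {lo..hi} \<Longrightarrow>
      separated \<gamma> a v \<Longrightarrow> separated \<gamma> a w \<Longrightarrow>
      \<exists>m\<in>N a v. \<forall>m'\<in>N a w. \<bar>v - m\<bar> \<le> \<bar>v - m'\<bar>"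
    and far: "\<And>a b. a \<in> {lo..hi} \<Longrightarrow> b \<in> {lo..hi} \<Longrightarrow> \<gamma> < \<bar>a - b\<bar> \<Longrightarrow> \<exists>m\<in>N a b. \<bar>b - m\<bar> \<le> \<rho>"
    and big: "lo + \<gamma> + 2 * \<rho> + \<tau> + 1 \<le> hi"
  shows "\<exists>a b. lo \<le> a \<and> a < b \<and> b \<le> a + \<tau> \<and> b \<le> hi \<and> a \<in> N a b"
proof -
  have "\<exists>a b. - hi \<le> a \<and> a < b \<and> b \<le> a + \<tau> \<and> b \<le> - lo \<and> b \<in> uminus ` N (- a) (- b)"
  proof (rule right_agent_served[OF \<gamma> \<rho> \<tau>])
    fix a v w assume *: "a \<in> {- hi..- lo}" "v \<in> {- hi..- lo}" "w \<in> {- hi..- lo}"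
      "separated \<gamma> a v" "separated \<gamma> a w"
    have "\<exists>m\<in>N (- a) (- v). \<forall>m'\<in>N (- a) (- w). \<bar>- v - m\<bar> \<le> \<bar>- v - m'\<bar>"
      by (rule sp) (use * in \<open>auto simp: separated_def abs_minus_commute\<close>)
    then show "\<exists>m\<in>uminus ` N (- a) (- v). \<forall>m'\<in>uminus ` N (- a) (- w). \<bar>v - m\<bar> \<le> \<bar>v - m'\<bar>"
      unfolding bex_simps(7) ball_simps(9) by (simp add: abs_minus_add_cancel)
  next
    fix a b assume *: "a \<in> {- hi..- lo}" "b \<in> {- hi..- lo}" "\<gamma> < \<bar>a - b\<bar>"
    have "\<exists>m\<in>N (- a) (- b). \<bar>- b - m\<bar> \<le> \<rho>"
      by (rule far) (use * in \<open>auto simp: abs_minus_commute\<close>)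
    then show "\<exists>m\<in>uminus ` N (- a) (- b). \<bar>b - m\<bar> \<le> \<rho>"
      unfolding bex_simps(7) by (simp add: abs_minus_add_cancel)
  next
    fix a b show "uminus ` N (- a) (- b) = uminus ` N (- b) (- a)" using sym by metis
  qed (use big in auto)
  then obtain a b where "- hi \<le> a" "a < b" "b \<le> a + \<tau>" "b \<le> - lo" "b \<in> uminus ` N (- a) (- b)"
    by blast
  moreover then have "- b \<in> N (- b) (- a)" using sym by force
  ultimately show ?thesis by (intro exI[of _ "- b"] exI[of _ "- a"]) auto
qed

subsection \<open>Stability of instances with a unique smallest gap\<close>

lemma dist_fac_le: "l \<in> set c \<Longrightarrow> dist_fac p c \<le> \<bar>p - l\<bar>"
  unfolding dist_fac_def by (intro Min_le) auto

lemma dist_fac_attained: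
  assumes "c \<noteq> []"
  obtains l where "l \<in> set c" "dist_fac p c = \<bar>p - l\<bar>"
proof -
  have "dist_fac p c \<in> (\<lambda>l. \<bar>p - l\<bar>) ` set c"
    unfolding dist_fac_def using assms by (intro Min_in) auto
  then show thesis using that by blast
qed

lemma dist_fac_nonneg: "c \<noteq> [] \<Longrightarrow> 0 \<le> dist_fac p c"
  by (metis abs_ge_zero dist_fac_attained)

lemma social_cost_nonneg: "c \<noteq> [] \<Longrightarrow> 0 \<le> social_cost x c"
  unfolding social_cost_def by (intro sum_nonneg dist_fac_nonneg)

lemma dist_fac_le_social_cost:
  assumes "c \<noteq> []" "i < length x"
  shows "dist_fac (x ! i) c \<le> social_cost x c"
  unfolding social_cost_def using assms
  by (intro member_le_sum[where f = "\<lambda>i. dist_fac (x ! i) c"]) (auto simp: dist_fac_nonneg)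

lemma two_dist_fac_le_social_cost:
  assumes "c \<noteq> []" "i < length x" "j < length x" "i \<noteq> j"
  shows "dist_fac (x ! i) c + dist_fac (x ! j) c \<le> social_cost x c"
proof -
  have "dist_fac (x ! i) c + dist_fac (x ! j) c = (\<Sum>l\<in>{i, j}. dist_fac (x ! l) c)"
    using assms by simp
  also have "\<dots> \<le> social_cost x c"
    unfolding social_cost_def using assms by (intro sum_mono2) (auto simp: dist_fac_nonneg)
  finally show ?thesis .
qed

text \<open>The \<open>m + k\<close> agents of a profile occupy \<open>k + 1\<close> sites: site \<open>0\<close> hosts the first \<open>m\<close> agents and site
  \<open>q > 0\<close> hosts agent \<open>m + q - 1\<close>. The smallest gap is the one between the sites \<open>e\<close> and \<open>e + 1\<close>.\<close>

definition site :: "nat \<Rightarrow> real list \<Rightarrow> nat \<Rightarrow> real" where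
  "site m x q = x ! (m + q - 1)"

definition closest_gap :: "nat \<Rightarrow> nat \<Rightarrow> nat \<Rightarrow> real list \<Rightarrow> bool" where
  "closest_gap m k e x \<longleftrightarrow> 0 < m \<and> e < k \<and> sorted x \<and> length x = m + k \<and>
     (\<forall>i<m. x ! i = hd x) \<and>
     (\<forall>q<k. q \<noteq> e \<longrightarrow>
        site m x (Suc e) - site m x e < site m x (Suc q) - site m x q)"

text \<open>Index of the first agent of cluster \<open>j\<close> when cluster \<open>e\<close> hosts
  the sites \<open>e\<close> and \<open>e + 1\<close> and every other cluster hosts one site; for
  \<open>j = k\<close> it is the number of agents.\<close>

definition gap_start :: "nat \<Rightarrow> nat \<Rightarrow> nat \<Rightarrow> nat" where
  "gap_start m e j = (if j = 0 then 0 else if j \<le> e then m - 1 + j else m + j)"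

definition gap_clustering :: "nat \<Rightarrow> nat \<Rightarrow> nat \<Rightarrow> nat list" where
  "gap_clustering m k e = map (\<lambda>j. gap_start m e (Suc j) - gap_start m e j) [0..<k]"

text \<open>One facility at every site except \<open>e + 1\<close>, whose agent uses the facility at
  site \<open>e\<close>.\<close>

definition gap_profile :: "nat \<Rightarrow> nat \<Rightarrow> nat \<Rightarrow> real list \<Rightarrow> real list" where
  "gap_profile m k e x = map (\<lambda>q. site m x (if q \<le> e then q else Suc q)) [0..<k]"

lemma length_gap_profile [simp]: "length (gap_profile m k e x) = k"
  by (simp add: gap_profile_def)

lemma gap_start_less: "0 < m \<Longrightarrow> i < j \<Longrightarrow> gap_start m e i < gap_start m e j"
  by (auto simp: gap_start_def)

lemma sum_list_take_gap_clustering: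
  assumes "0 < m" "j \<le> k"
  shows "sum_list (take j (gap_clustering m k e)) = gap_start m e j"
  using assms(2)
proof (induction j)
  case (Suc j)
  then have "take (Suc j) (gap_clustering m k e) = take j (gap_clustering m k e) @
      [gap_start m e (Suc j) - gap_start m e j]"
    by (simp add: take_Suc_conv_app_nth gap_clustering_def)
  then show ?case using Suc gap_start_less[OF assms(1), of j "Suc j" e] by simp
qed (simp add: gap_start_def)

lemma is_clustering_gap_clustering:
  assumes "0 < m" "e < k"
  shows "is_clustering k (m + k) (gap_clustering m k e)"
proof -
  have "sum_list (gap_clustering m k e) = gap_start m e k"
    using sum_list_take_gap_clustering[OF assms(1), of k k e] by (simp add: gap_clustering_def)
  then show ?thesis
    using assms gap_start_less[OF assms(1), of _ "Suc _" e]
    by (simp add: is_clustering_def gap_clustering_def) (simp add: gap_start_def)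
qed

text \<open>Positive sizes make the partial sums strictly increasing, so their set determines their
  list and thereby the sizes.\<close>

lemma clustering_eqI:
  assumes s: "is_clustering k n s" and s': "is_clustering k n s'"
    and eq: "(\<lambda>j. sum_list (take j s)) ` {..k} = (\<lambda>j. sum_list (take j s')) ` {..k}"
  shows "s = s'"
proof -
  let ?P = "\<lambda>s. map (\<lambda>j. sum_list (take j s)) [0..<Suc k]"
  have step: "sum_list (take (Suc j) s) = sum_list (take j s) + s ! j"
    if "is_clustering k n s" "j < k" for s :: "nat list" and j
    using that by (simp add: take_Suc_conv_app_nth is_clustering_def)
  have less: "sum_list (take i s) < sum_list (take j s)"
    if "is_clustering k n s" "i < j" "j \<le> k" for s :: "nat list" and i j
    using that(2,3)
  proof (induction j)
    case (Suc j)
    then show ?case using step[OF that(1), of j] that(1)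
      by (cases "i = j") (auto simp: is_clustering_def)
  qed simp
  have sw: "sorted_wrt (<) (?P s)" if "is_clustering k n s" for s :: "nat list"
    unfolding sorted_wrt_iff_nth_less using less[OF that] by (auto simp del: upt_Suc)
  have "set (?P s) = set (?P s')" using eq by (simp add: atLeast0LessThan lessThan_Suc_atMost del: upt_Suc)
  then have "?P s = ?P s'" using sw[OF s] sw[OF s'] by (intro strict_sorted_equal)
  then have take_eq: "sum_list (take j s) = sum_list (take j s')" if "j \<le> k" for j
    using that by (auto simp del: upt_Suc dest!: map_eq_conv[THEN iffD1])
  show ?thesis
  proof (rule nth_equalityI)
    show "length s = length s'" using s s' by (simp add: is_clustering_def)
    show "s ! j = s' ! j" if "j < length s" for j
    proof -
      have "j < k" using that s by (simp add: is_clustering_def)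
      then show ?thesis using step[OF s, of j] step[OF s', of j] take_eq[of j] take_eq[of "Suc j"] by simp
    qed
  qed
qed

lemma closest_gap_nonneg:
  assumes "closest_gap m k e x"
  shows "0 \<le> site m x (Suc e) - site m x e"
  using assms by (auto simp: closest_gap_def site_def sorted_iff_nth_mono)

lemma site_mono:
  assumes "closest_gap m k e x" "p \<le> q" "q \<le> k"
  shows "site m x p \<le> site m x q"
  using assms by (auto simp: closest_gap_def site_def sorted_iff_nth_mono)

lemma site_gap:
  assumes "closest_gap m k e x" "p < q" "q \<le> k"
  shows "site m x (Suc e) - site m x e \<le> site m x q - site m x p"
proof -
  have "site m x (Suc e) - site m x e \<le> site m x (Suc p) - site m x p"
    using assms by (cases "p = e") (auto simp: closest_gap_def less_imp_le)
  moreover have "site m x (Suc p) \<le> site m x q" using assms by (intro site_mono) auto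
  ultimately show ?thesis by linarith
qed

text \<open>By the pigeonhole principle two of the \<open>k + 1\<close> sites share a nearest
  facility, and their agents together pay at least the distance of these sites.\<close>

lemma social_cost_ge_gap:
  assumes x: "closest_gap m k e x" and c: "length c = k"
  shows "site m x (Suc e) - site m x e \<le> social_cost x c"
proof -
  have ne: "c \<noteq> []" using x c by (auto simp: closest_gap_def)
  have "\<forall>q. \<exists>l. l \<in> set c \<and> dist_fac (site m x q) c = \<bar>site m x q - l\<bar>"
    using dist_fac_attained[OF ne] by metis
  then obtain l where l: "\<And>q. l q \<in> set c" "\<And>q. dist_fac (site m x q) c = \<bar>site m x q - l q\<bar>"
    by metis
  have "card (l ` {..k}) \<le> card (set c)" using l by (intro card_mono) auto
  also have "\<dots> < card {..k}" using card_length[of c] c by simp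
  finally have "\<not> inj_on l {..k}" by (rule pigeonhole)
  then obtain p q where pq: "p < q" "q \<le> k" "l p = l q"
    unfolding inj_on_def by (metis atMost_iff linorder_neqE_nat)
  have "site m x (Suc e) - site m x e \<le> site m x q - site m x p" using site_gap[OF x] pq by simp
  also have "\<dots> \<le> dist_fac (site m x p) c + dist_fac (site m x q) c"
    unfolding l(2) using pq(3) by (simp add: abs_if)
  also have "\<dots> \<le> social_cost x c"
    unfolding site_def using x pq by (intro two_dist_fac_le_social_cost[OF ne]) (auto simp: closest_gap_def)
  finally show ?thesis .
qed

lemma site_in_gap_profile:
  assumes "e < k" "q \<le> k" "q \<noteq> Suc e"
  shows "site m x q \<in> set (gap_profile m k e x)"
proof (cases "q \<le> e")
  case True
  then show ?thesis using assms by (force simp: gap_profile_def)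
next
  case False
  then show ?thesis using assms
    by (auto simp: gap_profile_def image_iff intro!: bexI[of _ "q - 1"])
qed

lemma agent_site:
  assumes "closest_gap m k e x" "i < m + k"
  shows "x ! i = site m x (Suc i - m)"
proof (cases "i < m")
  case True
  have "x ! i = hd x" "x ! (m - 1) = hd x" using assms True by (auto simp: closest_gap_def)
  then show ?thesis using True by (simp add: site_def)
qed (simp add: site_def)

lemma dist_fac_gap_profile:
  assumes x: "closest_gap m k e x" and i: "i < m + k" "i \<noteq> m + e"
  shows "dist_fac (x ! i) (gap_profile m k e x) = 0"
proof -
  have e: "e < k" "0 < m" using x by (auto simp: closest_gap_def)
  then have ne: "gap_profile m k e x \<noteq> []" by (simp add: gap_profile_def)
  have "x ! i \<in> set (gap_profile m k e x)"
    unfolding agent_site[OF x i(1)] using e i by (intro site_in_gap_profile) auto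
  from dist_fac_le[OF this, of "x ! i"] dist_fac_nonneg[OF ne, of "x ! i"] show ?thesis by simp
qed

lemma dist_fac_gap_profile_pair:
  assumes x: "closest_gap m k e x"
  shows "dist_fac (x ! (m + e)) (gap_profile m k e x) = site m x (Suc e) - site m x e"
proof (rule antisym)
  have e: "e < k" "0 < m" using x by (auto simp: closest_gap_def)
  then have ne: "gap_profile m k e x \<noteq> []" by (simp add: gap_profile_def)
  have s: "x ! (m + e) = site m x (Suc e)" by (simp add: site_def)
  show "dist_fac (x ! (m + e)) (gap_profile m k e x) \<le> site m x (Suc e) - site m x e"
    using dist_fac_le[OF site_in_gap_profile[of e k e m x], of "site m x (Suc e)"] e closest_gap_nonneg[OF x]
    by (simp add: s)
  obtain l where l: "l \<in> set (gap_profile m k e x)"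
    "dist_fac (x ! (m + e)) (gap_profile m k e x) = \<bar>site m x (Suc e) - l\<bar>"
    using dist_fac_attained[OF ne] s by metis
  then obtain p where p: "p < k" "l = site m x (if p \<le> e then p else Suc p)"
    by (auto simp: gap_profile_def)
  define q where "q = (if p \<le> e then p else Suc p)"
  have q: "q \<le> k" "q \<noteq> Suc e" "l = site m x q" using p by (auto simp: q_def)
  have "site m x (Suc e) - site m x e \<le> \<bar>site m x (Suc e) - l\<bar>"
    using site_gap[OF x, of q "Suc e"] site_gap[OF x, of "Suc e" q] q e
    by (cases "q < Suc e") auto
  then show "site m x (Suc e) - site m x e \<le> dist_fac (x ! (m + e)) (gap_profile m k e x)"
    using l by simp
qed

lemma social_cost_gap_profile:
  assumes x: "closest_gap m k e x"
  shows "social_cost x (gap_profile m k e x) = site m x (Suc e) - site m x e"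
proof -
  have e: "e < k" "length x = m + k" using x by (auto simp: closest_gap_def)
  have "social_cost x (gap_profile m k e x) =
      dist_fac (x ! (m + e)) (gap_profile m k e x) +
      (\<Sum>i\<in>{..<m + k} - {m + e}. dist_fac (x ! i) (gap_profile m k e x))"
    unfolding social_cost_def e(2) using e by (intro sum.remove) auto
  also have "(\<Sum>i\<in>{..<m + k} - {m + e}. dist_fac (x ! i) (gap_profile m k e x)) = 0"
    by (intro sum.neutral) (auto simp: dist_fac_gap_profile[OF x])
  finally show ?thesis using dist_fac_gap_profile_pair[OF x] by simp
qed

lemma optimal_profile_gap_profile:
  assumes x: "closest_gap m k e x"
  shows "optimal_profile k x (gap_profile m k e x)"
  unfolding optimal_profile_def social_cost_gap_profile[OF x]
  using social_cost_ge_gap[OF x] by (simp add: gap_profile_def)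

lemma opt_cost_closest_gap:
  assumes x: "closest_gap m k e x"
  shows "opt_cost k x = site m x (Suc e) - site m x e"
  unfolding opt_cost_def
proof (rule cInf_eq_minimum)
  show "site m x (Suc e) - site m x e \<in> {social_cost x c |c. length c = k}"
    using social_cost_gap_profile[OF x, symmetric] length_gap_profile by blast
qed (use social_cost_ge_gap[OF x] in auto)

lemma optimal_clustering_gap_clustering:
  assumes x: "closest_gap m k e x"
  shows "optimal_clustering k x (gap_clustering m k e)"
proof -
  have e: "e < k" "0 < m" "length x = m + k" using x by (auto simp: closest_gap_def)
  have "induced_by x (gap_clustering m k e) (gap_profile m k e x)"
    unfolding induced_by_def
  proof (intro conjI allI impI)
    fix j i assume j: "j < length (gap_clustering m k e)" and i: "i < length x"
      and c: "in_cluster (gap_clustering m k e) j i"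
    have jk: "j < k" using j by (simp add: gap_clustering_def)
    have ij: "gap_start m e j \<le> i" "i < gap_start m e (Suc j)"
      using c jk e by (auto simp: in_cluster_def sum_list_take_gap_clustering)
    have cj: "gap_profile m k e x ! j = site m x (if j \<le> e then j else Suc j)"
      using jk by (simp add: gap_profile_def)
    have xi: "x ! i = site m x (Suc i - m)" using agent_site[OF x] i e by simp
    show "\<bar>x ! i - gap_profile m k e x ! j\<bar> = dist_fac (x ! i) (gap_profile m k e x)"
    \<comment> \<open>Agent \<open>m + e\<close> occupies site \<open>e + 1\<close>, the only site
      skipped by \<open>gap_profile\<close>.\<close>
    proof (cases "i = m + e")
      case True
      then have "j = e" using ij e by (auto simp: gap_start_def split: if_splits)
      then show ?thesis
        using dist_fac_gap_profile_pair[OF x] closest_gap_nonneg[OF x] xi cj True by simp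
    next
      case False
      have "Suc i - m = (if j \<le> e then j else Suc j)"
        using ij False e by (auto simp: gap_start_def split: if_splits)
      then show ?thesis using dist_fac_gap_profile[OF x, of i] i e False xi cj by simp
    qed
  qed (simp add: gap_clustering_def gap_profile_def)
  then show ?thesis
    using is_clustering_gap_clustering[OF e(2,1)] optimal_profile_gap_profile[OF x] e
    by (auto simp: optimal_clustering_def)
qed

section \<open>Uniqueness of the optimal clustering\<close>

lemma clustering_covers:
  assumes "is_clustering k n s" "i < n"
  obtains j where "j < k" "in_cluster s j i"
proof -
  define j where "j = (LEAST j. i < sum_list (take (Suc j) s))"
  have k: "0 < k" using assms by (cases k) (auto simp: is_clustering_def)
  have ex: "i < sum_list (take (Suc (k - 1)) s)" using assms k by (auto simp: is_clustering_def)
  have lt: "i < sum_list (take (Suc j) s)" unfolding j_def using ex by (rule LeastI)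
  have "j \<le> k - 1" unfolding j_def using ex by (rule Least_le)
  moreover have "sum_list (take j s) \<le> i"
  proof (cases j)
    case (Suc j')
    then have "\<not> i < sum_list (take (Suc j') s)"
      using not_less_Least[of j' "\<lambda>j. i < sum_list (take (Suc j) s)"] j_def by simp
    then show ?thesis using Suc by simp
  qed simp
  ultimately show thesis using that[of j] lt k by (auto simp: in_cluster_def)
qed

text \<open>Agents on both sides of a gap other than \<open>e\<close> cannot share a facility, since
  that alone would cost more than the optimum. This forces \<open>k - 1\<close> cuts, which is all
  that a clustering into \<open>k\<close> sets has.\<close>

lemma optimal_clustering_unique:
  assumes x: "closest_gap m k e x" and s: "optimal_clustering k x s"
  shows "s = gap_clustering m k e"
proof -
  have e: "e < k" "0 < m" "length x = m + k" using x by (auto simp: closest_gap_def)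
  have cl: "is_clustering k (m + k) s" using s e by (simp add: optimal_clustering_def)
  obtain c where c: "optimal_profile k x c" "induced_by x s c"
    using s by (auto simp: optimal_clustering_def)
  have ck: "length c = k" using c by (simp add: optimal_profile_def)
  then have ne: "c \<noteq> []" using e by auto
  have cost: "social_cost x c \<le> site m x (Suc e) - site m x e"
    using c(1) social_cost_gap_profile[OF x] unfolding optimal_profile_def
    by (metis length_gap_profile)
  let ?P = "\<lambda>j. sum_list (take j s)"
  \<comment> \<open>Agent \<open>m + q\<close> is the first one to the right of gap
    \<open>q\<close>, so a cut in this gap is a partial sum equal to \<open>m + q\<close>.\<close>
  have bd: "m + q \<in> ?P ` {1..<k}" if q: "q < k" "q \<noteq> e" for q
  proof -
    have "m + q - 1 < m + k" using q e by linarith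
    then obtain j where j: "j < k" "in_cluster s j (m + q - 1)"
      using clustering_covers[OF cl] by blast
    have "\<not> in_cluster s j (m + q)"
    proof
      assume j': "in_cluster s j (m + q)"
      have "\<bar>x ! (m + q - 1) - c ! j\<bar> = dist_fac (x ! (m + q - 1)) c"
        "\<bar>x ! (m + q) - c ! j\<bar> = dist_fac (x ! (m + q)) c"
        using c(2) j j' q e cl unfolding induced_by_def is_clustering_def by auto
      moreover have "dist_fac (x ! (m + q - 1)) c + dist_fac (x ! (m + q)) c \<le> social_cost x c"
        using q e by (intro two_dist_fac_le_social_cost[OF ne]) auto
      moreover have "site m x (Suc e) - site m x e < x ! (m + q) - x ! (m + q - 1)"
        using x q by (simp add: closest_gap_def site_def)
      ultimately show False using cost by linarith
    qed
    then have eq: "m + q = ?P (Suc j)" using j(2) e by (auto simp: in_cluster_def)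
    have "Suc j \<noteq> k" using eq cl q by (auto simp: is_clustering_def)
    then show ?thesis using eq j(1) by (intro image_eqI[of _ _ "Suc j"]) auto
  qed
  have sub: "(\<lambda>q. m + q) ` ({..<k} - {e}) \<subseteq> ?P ` {1..<k}" using bd by auto
  have "card ((\<lambda>q. m + q) ` ({..<k} - {e})) = k - 1"
    using e by (subst card_image) (auto simp: inj_on_def)
  moreover have "card (?P ` {1..<k}) \<le> k - 1" using card_image_le[of "{1..<k}" ?P] by simp
  \<comment> \<open>There are at most \<open>k - 1\<close> inner partial sums, so the forced cuts
    exhaust them.\<close>
  ultimately have img: "?P ` {1..<k} = (\<lambda>q. m + q) ` ({..<k} - {e})"
    using sub by (intro card_seteq[symmetric]) auto
  have split: "{..k} = insert 0 (insert k {1..<k})" using e by auto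
  have full: "(\<lambda>j. sum_list (take j t)) ` {..k} =
      insert 0 (insert (m + k) ((\<lambda>q. m + q) ` ({..<k} - {e})))"
    if "is_clustering k (m + k) t"
      "(\<lambda>j. sum_list (take j t)) ` {1..<k} = (\<lambda>q. m + q) ` ({..<k} - {e})" for t
  proof -
    have "sum_list (take k t) = m + k" using that(1) by (simp add: is_clustering_def)
    then show ?thesis using that(2) unfolding split by simp
  qed
  have "gap_start m e ` {1..<k} = (\<lambda>q. m + q) ` ({..<k} - {e})"
  proof (intro equalityI subsetI)
    fix p assume "p \<in> gap_start m e ` {1..<k}"
    then obtain j where j: "1 \<le> j" "j < k" "p = gap_start m e j" by auto
    then show "p \<in> (\<lambda>q. m + q) ` ({..<k} - {e})"
      using e by (intro image_eqI[of _ _ "if j \<le> e then j - 1 else j"]) (auto simp: gap_start_def)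
  next
    fix p assume "p \<in> (\<lambda>q. m + q) ` ({..<k} - {e})"
    then obtain q where q: "q < k" "q \<noteq> e" "p = m + q" by auto
    then show "p \<in> gap_start m e ` {1..<k}"
      using e by (intro image_eqI[of _ _ "if q < e then Suc q else q"]) (auto simp: gap_start_def)
  qed
  moreover have "(\<lambda>j. sum_list (take j (gap_clustering m k e))) ` {1..<k} = gap_start m e ` {1..<k}"
    using e by (intro image_cong) (auto simp: sum_list_take_gap_clustering)
  ultimately have "(\<lambda>j. sum_list (take j (gap_clustering m k e))) ` {..k} = ?P ` {..k}"
    using full[OF cl img] full[OF is_clustering_gap_clustering[OF e(2,1)]] by simp
  then show ?thesis
    using clustering_eqI[OF cl is_clustering_gap_clustering[OF e(2,1)]] by simp
qed

lemma optimal_clustering_iff: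
  assumes "closest_gap m k e x"
  shows "optimal_clustering k x s \<longleftrightarrow> s = gap_clustering m k e"
  using optimal_clustering_unique[OF assms] optimal_clustering_gap_clustering[OF assms] by blast

text \<open>Gap \<open>e\<close> cannot grow and any other gap shrinks at most by the factor
  \<open>\<gamma>\<close>, so a lead of more than \<open>\<gamma>\<close> survives.\<close>

lemma perturbation_closest_gap:
  assumes x: "closest_gap m k e x" and \<gamma>: "1 \<le> \<gamma>"
    and gap: "\<And>q. q < k \<Longrightarrow> q \<noteq> e \<Longrightarrow>
      \<gamma> * (site m x (Suc e) - site m x e) < site m x (Suc q) - site m x q"
    and x': "perturbation \<gamma> x x'"
  shows "closest_gap m k e x'"
proof -
  have e: "e < k" "0 < m" "length x = m + k" "sorted x" "\<And>i. i < m \<Longrightarrow> x ! i = hd x"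
    using x by (auto simp: closest_gap_def)
  have p: "sorted x'" "length x' = m + k"
    and d: "\<And>i. Suc i < m + k \<Longrightarrow> \<bar>x ! i - x ! Suc i\<bar> / \<gamma> \<le> \<bar>x' ! i - x' ! Suc i\<bar> \<and>
        \<bar>x' ! i - x' ! Suc i\<bar> \<le> \<bar>x ! i - x ! Suc i\<bar>"
    using x' e by (auto simp: perturbation_def)
  have mono: "x ! i \<le> x ! Suc i" "x' ! i \<le> x' ! Suc i" if "Suc i < m + k" for i
    using that e p by (auto simp: sorted_iff_nth_mono)
  have d': "(x ! Suc i - x ! i) / \<gamma> \<le> x' ! Suc i - x' ! i" "x' ! Suc i - x' ! i \<le> x ! Suc i - x ! i"
    if "Suc i < m + k" for i
    using d[OF that] mono[OF that] by (simp_all add: abs_if split: if_splits)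
  \<comment> \<open>Gaps of length 0 stay 0, which keeps the first \<open>m\<close> agents
    together.\<close>
  have bulk: "x' ! i = x' ! 0" if "i < m" for i
    using that
  proof (induction i)
    case (Suc i)
    have "x ! Suc i = x ! i" using e(5)[of i] e(5)[of "Suc i"] Suc.prems by simp
    then show ?case using d'[of i] mono[of i] Suc e by force
  qed simp
  have s: "(site m x (Suc q) - site m x q) / \<gamma> \<le> site m x' (Suc q) - site m x' q"
      "site m x' (Suc q) - site m x' q \<le> site m x (Suc q) - site m x q" if "q < k" for q
    using d'[of "m + q - 1"] that e by (auto simp: site_def)
  have "site m x' (Suc e) - site m x' e < site m x' (Suc q) - site m x' q" if q: "q < k" "q \<noteq> e" for q
  proof -
    have "site m x (Suc e) - site m x e < (site m x (Suc q) - site m x q) / \<gamma>"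
      using gap[OF q] \<gamma> by (simp add: field_simps)
    then show ?thesis using s(1)[OF q(1)] s(2)[OF e(1)] by linarith
  qed
  moreover have "x' ! i = hd x'" if "i < m" for i
    using bulk[OF that] p e hd_conv_nth[of x'] by fastforce
  ultimately show ?thesis using e p unfolding closest_gap_def by blast
qed

lemma stable_sorted_closest_gap:
  assumes x: "closest_gap m k e x" and \<gamma>: "1 \<le> \<gamma>"
    and gap: "\<And>q. q < k \<Longrightarrow> q \<noteq> e \<Longrightarrow>
      \<gamma> * (site m x (Suc e) - site m x e) < site m x (Suc q) - site m x q"
  shows "stable_sorted \<gamma> k x"
proof -
  have "optimal_clustering k y = (\<lambda>s. s = gap_clustering m k e)"
    if "y = x \<or> perturbation \<gamma> x y" for y
    using that optimal_clustering_iff[OF x] optimal_clustering_iff[OF perturbation_closest_gap[OF x \<gamma> gap]]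
    by (intro ext) auto
  then show ?thesis by (simp add: stable_sorted_def)
qed

subsection \<open>The two-parameter family of instances\<close>

text \<open>The first gap has length 1. All later gaps, including the one up to a free agent at
  \<open>2 * real k\<close> or beyond, are at least 2 and thus exceed
  \<open>\<gamma>\<close>.\<close>

definition base :: "nat \<Rightarrow> nat \<Rightarrow> real list" where
  "base m k = replicate m 0 @ map (\<lambda>j. 1 + 2 * real j) [0..<k - 2]"

lemma length_base: "3 \<le> k \<Longrightarrow> length (base m k) = m + k - 2"
  by (simp add: base_def)

lemma sorted_base: "sorted (base m k)"
proof -
  have "sorted (map (\<lambda>j. 1 + 2 * real j) [0..<k - 2])"
    unfolding sorted_iff_nth_mono by simp
  then show ?thesis by (auto simp: base_def sorted_append)
qed

lemma set_base_bounds: "3 \<le> k \<Longrightarrow> p \<in> set (base m k) \<Longrightarrow> 0 \<le> p \<and> p \<le> 2 * real k - 5"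
  by (auto simp: base_def)

lemma site_base:
  assumes "0 < m" "3 \<le> k" "q \<le> k - 2"
  shows "site m (base m k @ [a, b]) q = (if q = 0 then 0 else 2 * real q - 1)"
  using assms by (auto simp: site_def base_def nth_append of_nat_diff)

lemma site_base_last:
  assumes "0 < m" "3 \<le> k"
  shows "site m (base m k @ [a, b]) (k - 1) = a" "site m (base m k @ [a, b]) k = b"
proof -
  have "m + (k - 1) - 1 = length (base m k) + 0" "m + k - 1 = length (base m k) + 1"
    using assms by (auto simp: length_base)
  then show "site m (base m k @ [a, b]) (k - 1) = a" "site m (base m k @ [a, b]) k = b"
    unfolding site_def by (simp_all only: nth_append_length_plus) auto
qed

lemma site_gap_base:
  assumes "0 < m" "3 \<le> k" "2 * real k \<le> a" "q < k - 1"
  shows "site m (base m k @ [a, b]) (Suc q) - site m (base m k @ [a, b]) q = 1 \<and> q = 0 \<or>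
    2 \<le> site m (base m k @ [a, b]) (Suc q) - site m (base m k @ [a, b]) q \<and> 0 < q"
proof (cases "q = k - 2")
  case True
  then have "Suc q = k - 1" using assms by simp
  then show ?thesis using True assms site_base[of m k q a b] site_base_last(1)[of m k a b]
    by (auto simp: of_nat_diff)
next
  case False
  then show ?thesis using assms site_base[of m k q a b] site_base[of m k "Suc q" a b] by auto
qed

lemma closest_gap_baseI:
  assumes "0 < m" "3 \<le> k" "2 * real k \<le> a" "a \<le> b" "e < k"
    "\<And>q. q < k \<Longrightarrow> q \<noteq> e \<Longrightarrow> site m (base m k @ [a, b]) (Suc e) - site m (base m k @ [a, b]) e
      < site m (base m k @ [a, b]) (Suc q) - site m (base m k @ [a, b]) q"
  shows "closest_gap m k e (base m k @ [a, b])"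
proof -
  have "sorted (base m k @ [a, b])"
    using sorted_base set_base_bounds[OF assms(2)] assms by (fastforce simp: sorted_append)
  moreover have "(base m k @ [a, b]) ! i = hd (base m k @ [a, b])" if "i < m" for i
  proof -
    have "hd (base m k @ [a, b]) = 0" using assms(1) by (cases m) (simp_all add: base_def)
    then show ?thesis using that by (simp add: base_def nth_append)
  qed
  ultimately show ?thesis using assms by (simp add: closest_gap_def length_base)
qed

lemma sort_base:
  assumes "3 \<le> k" "2 * real k \<le> a" "2 * real k \<le> b"
  shows "sort (base m k @ [a, b]) = base m k @ [min a b, max a b]"
proof (rule properties_for_sort)
  show "sorted (base m k @ [min a b, max a b])"
    using sorted_base set_base_bounds[OF assms(1)] assms by (fastforce simp: sorted_append)
qed (auto simp: min_def max_def)

text \<open>Even multiplied by \<open>\<gamma>\<close>, the gap \<open>b - a\<close> stays below 1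
  and hence below all fixed gaps; it is gap \<open>k - 1\<close>.\<close>

lemma close_pair:
  fixes \<gamma> :: real
  assumes "1 \<le> \<gamma>" "0 < m" "3 \<le> k" "2 * real k \<le> a" "a \<le> b" "b - a < 1 / \<gamma>"
  shows "stable_sorted \<gamma> k (base m k @ [a, b])" "opt_cost k (base m k @ [a, b]) = b - a"
proof -
  let ?x = "base m k @ [a, b]"
  have e: "site m ?x (Suc (k - 1)) - site m ?x (k - 1) = b - a"
    using assms site_base_last[of m k a b] by simp
  have g: "\<gamma> * (b - a) < site m ?x (Suc q) - site m ?x q" if "q < k" "q \<noteq> k - 1" for q
  proof -
    have "\<gamma> * (b - a) < 1" using assms by (simp add: field_simps)
    then show ?thesis using site_gap_base[of m k a q b] assms(2-4) that by fastforce
  qed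
  have "b - a \<le> \<gamma> * (b - a)" using assms by (simp add: mult_le_cancel_right1)
  then have x: "closest_gap m k (k - 1) ?x"
    using assms g e by (intro closest_gap_baseI) force+
  show "stable_sorted \<gamma> k ?x"
    using g e assms by (intro stable_sorted_closest_gap[OF x]) auto
  show "opt_cost k ?x = b - a" using opt_cost_closest_gap[OF x] e by simp
qed

text \<open>Now gap \<open>0\<close>, of length 1, is the smallest, and all others exceed
  \<open>\<gamma>\<close>.\<close>

lemma distant_pair:
  fixes \<gamma> :: real
  assumes "1 \<le> \<gamma>" "\<gamma> < 2" "0 < m" "3 \<le> k" "2 * real k \<le> a" "\<gamma> < b - a"
  shows "stable_sorted \<gamma> k (base m k @ [a, b])" "opt_cost k (base m k @ [a, b]) = 1"
proof -
  let ?x = "base m k @ [a, b]"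
  have e: "site m ?x (Suc 0) - site m ?x 0 = 1"
    using assms site_gap_base[of m k a 0 b] by simp
  have g: "\<gamma> * 1 < site m ?x (Suc q) - site m ?x q" if "q < k" "q \<noteq> 0" for q
  proof (cases "q = k - 1")
    case True
    then show ?thesis using assms site_base_last[of m k a b] by simp
  next
    case False
    then have "q < k - 1" using that by simp
    then show ?thesis using site_gap_base[of m k a q b] assms that by auto
  qed
  have x: "closest_gap m k 0 ?x"
    using assms g e by (intro closest_gap_baseI) force+
  show "stable_sorted \<gamma> k ?x"
    using g e assms by (intro stable_sorted_closest_gap[OF x]) auto
  show "opt_cost k ?x = 1" using opt_cost_closest_gap[OF x] e by simp
qed

section \<open>Contradiction from a mechanism with bounded ratio\<close>

locale bounded_mechanism =
  fixes m k :: nat and \<gamma> \<rho> :: real and M :: "real list \<Rightarrow> real list"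
  assumes m: "0 < m" and k: "3 \<le> k" and \<gamma>: "1 \<le> \<gamma>" "\<gamma> * \<gamma> < 2" and \<rho>: "1 \<le> \<rho>"
    and length_M: "length x = m + k \<Longrightarrow> length (M x) = k"
    and anonymous: "anonymous (m + k) M"
    and strategyproof: "strategyproof_stable (m + k) k \<gamma> M"
    and bounded: "length x = m + k \<Longrightarrow> stable \<gamma> k x \<Longrightarrow> social_cost x (M x) \<le> \<rho> * opt_cost k x"
begin

definition N :: "real \<Rightarrow> real \<Rightarrow> real set" where
  "N a b = set (M (base m k @ [a, b]))"

definition lo :: real where "lo = 2 * real k"

text \<open>For a pair of width at most \<open>\<tau>\<close> the mechanism may spend at most
  \<open>\<rho> * \<tau>\<close>, that is \<open>1 / 4\<close>.\<close>

definition \<tau> :: real where "\<tau> = 1 / (4 * \<rho>)"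

lemma \<gamma>_less_2: "\<gamma> < 2"
  using \<gamma> mult_mono[of 2 \<gamma> 2 \<gamma>] by (cases "\<gamma> < 2") auto

lemma \<tau>: "0 < \<tau>" "\<tau> \<le> 1 / 4" "\<tau> < 1 / \<gamma>"
proof -
  show "0 < \<tau>" "\<tau> \<le> 1 / 4" using \<rho> by (auto simp: \<tau>_def field_simps)
  moreover have "1 / 4 < 1 / \<gamma>" using \<gamma> \<gamma>_less_2 by (simp add: field_simps)
  ultimately show "\<tau> < 1 / \<gamma>" by linarith
qed

lemma length_profile: "length (base m k @ [a, b]) = m + k"
  using k by (simp add: length_base)

lemma M_ne: "M (base m k @ [a, b]) \<noteq> []"
  using length_M[OF length_profile, of a b] k by auto

lemma N_sym: "N a b = N b a"
proof -
  have "mset (base m k @ [a, b]) = mset (base m k @ [b, a])" by simp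
  then have "M (base m k @ [a, b]) = M (base m k @ [b, a])"
    using anonymous length_profile unfolding anonymous_def by blast
  then show ?thesis by (simp add: N_def)
qed

lemma stable_profile:
  assumes "lo \<le> a" "lo \<le> b" "separated \<gamma> a b"
  shows "stable \<gamma> k (base m k @ [a, b])"
proof -
  have "sort (base m k @ [a, b]) = base m k @ [min a b, max a b]"
    using k assms by (intro sort_base) (auto simp: lo_def)
  moreover have "stable_sorted \<gamma> k (base m k @ [min a b, max a b])"
    using assms close_pair(1)[OF \<gamma>(1) m k, of "min a b" "max a b"]
      distant_pair(1)[OF \<gamma>(1) \<gamma>_less_2 m k, of "min a b" "max a b"]
    by (auto simp: separated_def lo_def min_def max_def abs_if split: if_splits)
  ultimately show ?thesis by (simp add: stable_def)
qed

text \<open>The deviating free agent is the last entry of the list. By \<open>N_sym\<close> the same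
  bound is available for the other free agent.\<close>

lemma N_strategyproof:
  assumes "lo \<le> a" "lo \<le> v" "lo \<le> w" "separated \<gamma> a v" "separated \<gamma> a w"
  shows "\<exists>p\<in>N a v. \<forall>p'\<in>N a w. \<bar>v - p\<bar> \<le> \<bar>v - p'\<bar>"
proof -
  let ?x = "base m k @ [a, v]"
  have i: "m + k - 1 = length (base m k) + 1" using k m by (simp add: length_base)
  have upd: "?x[m + k - 1 := w] = base m k @ [a, w]" unfolding i by (simp add: list_update_append)
  have nth: "?x ! (m + k - 1) = v" unfolding i by (simp only: nth_append_length_plus) simp
  have "dist_fac (?x ! (m + k - 1)) (M ?x) \<le> dist_fac (?x ! (m + k - 1)) (M (?x[m + k - 1 := w]))"
    using strategyproof stable_profile assms m unfolding strategyproof_stable_def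
    by (metis upd length_profile add_gr_0 diff_less zero_less_one)
  then have le: "dist_fac v (M ?x) \<le> dist_fac v (M (base m k @ [a, w]))" by (simp only: upd nth)
  obtain p where "p \<in> set (M ?x)" "dist_fac v (M ?x) = \<bar>v - p\<bar>"
    using dist_fac_attained[OF M_ne] by blast
  then show ?thesis unfolding N_def using le dist_fac_le[of _ "M (base m k @ [a, w])" v]
    by (intro bexI[of _ p]) force+
qed

lemma served_within:
  assumes "p \<in> set (base m k @ [a, b])" "lo \<le> a" "lo \<le> b" "separated \<gamma> a b"
  shows "\<exists>c\<in>N a b. \<bar>p - c\<bar> \<le> \<rho> * opt_cost k (base m k @ [a, b])"
proof -
  let ?x = "base m k @ [a, b]"
  obtain i where i: "i < length ?x" "?x ! i = p" using assms(1) by (metis in_set_conv_nth)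
  obtain c where "c \<in> set (M ?x)" "dist_fac p (M ?x) = \<bar>p - c\<bar>"
    using dist_fac_attained[OF M_ne] by blast
  moreover have "dist_fac p (M ?x) \<le> social_cost ?x (M ?x)"
    using dist_fac_le_social_cost[OF M_ne i(1)] i(2) by simp
  moreover have "social_cost ?x (M ?x) \<le> \<rho> * opt_cost k ?x"
    using bounded[OF length_profile stable_profile] assms by blast
  ultimately show ?thesis unfolding N_def by force
qed

lemma served_distant:
  assumes "lo \<le> a" "lo \<le> b" "\<gamma> < \<bar>a - b\<bar>"
  shows "\<exists>c\<in>N a b. \<bar>b - c\<bar> \<le> \<rho>"
proof (cases "a \<le> b")
  case True
  then have "opt_cost k (base m k @ [a, b]) = 1"
    using assms distant_pair(2)[OF \<gamma>(1) \<gamma>_less_2 m k, of a b] by (auto simp: lo_def)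
  then show ?thesis using served_within[of b a b] assms by (auto simp: separated_def)
next
  case False
  then have "opt_cost k (base m k @ [b, a]) = 1"
    using assms distant_pair(2)[OF \<gamma>(1) \<gamma>_less_2 m k, of b a] by (auto simp: lo_def)
  then show ?thesis using served_within[of b b a] assms N_sym[of a b]
    by (auto simp: separated_def abs_minus_commute)
qed

lemma served_coincident: "lo \<le> a \<Longrightarrow> a \<in> N a a"
  using served_within[of a a a] close_pair(2)[OF \<gamma>(1) m k, of a a] \<gamma>
  by (auto simp: separated_def lo_def)

text \<open>Each of the \<open>k - 1\<close> fixed sites has a facility within \<open>1 / 4\<close>.
  The sites are at least 1 apart, so these facilities are distinct; they lie to the left of
  \<open>lo - 1\<close>, and only one of the \<open>k\<close> facilities remains.\<close>

lemma unique_facility: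
  assumes ab: "lo \<le> a" "a \<le> b" "b \<le> a + \<tau>"
    and c: "c \<in> N a b" "c' \<in> N a b" "lo - 1 \<le> c" "lo - 1 \<le> c'"
  shows "c = c'"
proof (rule ccontr)
  assume ne: "c \<noteq> c'"
  let ?x = "base m k @ [a, b]" and ?S = "site m (base m k @ [a, b])"
  have "b - a < 1 / \<gamma>" using ab \<tau> by linarith
  then have oc: "opt_cost k ?x = b - a" and sep: "separated \<gamma> a b"
    using ab close_pair(2)[OF \<gamma>(1) m k, of a b] by (auto simp: lo_def separated_def)
  have "\<rho> * (b - a) \<le> \<rho> * \<tau>" using ab \<rho> by (intro mult_left_mono) auto
  also have "\<dots> = 1 / 4" using \<rho> by (simp add: \<tau>_def)
  finally have small: "\<rho> * opt_cost k ?x \<le> 1 / 4" using oc by simp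
  have "\<exists>l\<in>N a b. \<bar>?S q - l\<bar> \<le> 1 / 4" if "q < k - 1" for q
  proof -
    have "m + q - 1 < length ?x" using that m by (simp only: length_profile)
    then have "?S q \<in> set ?x" unfolding site_def by (rule nth_mem)
    then obtain l where "l \<in> N a b" "\<bar>?S q - l\<bar> \<le> \<rho> * opt_cost k ?x"
      using served_within[of "?S q" a b] ab sep by auto
    then show ?thesis using small by (intro bexI[of _ l]) linarith+
  qed
  then obtain l where l: "\<And>q. q < k - 1 \<Longrightarrow> l q \<in> N a b \<and> \<bar>?S q - l q\<bar> \<le> 1 / 4" by metis
  have S: "?S q = (if q = 0 then 0 else 2 * real q - 1)" if "q < k - 1" for q
    using site_base[OF m k] that by auto
  have inj: "inj_on l {..<k - 1}"
  proof (rule inj_onI)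
    fix p q assume pq: "p \<in> {..<k - 1}" "q \<in> {..<k - 1}" "l p = l q"
    then have "\<bar>?S p - ?S q\<bar> \<le> 1 / 2" using l[of p] l[of q] by (simp add: abs_if split: if_splits)
    then show "p = q" using S pq by (cases p; cases q) (auto simp: abs_if split: if_splits)
  qed
  have left: "l q < lo - 1" if "q < k - 1" for q
  proof -
    have "real q \<le> real k - 2" using that k by (simp add: of_nat_diff flip: of_nat_le_iff)
    then show ?thesis using l[OF that] S[OF that] k by (auto simp: lo_def abs_if split: if_splits)
  qed
  have "c \<notin> l ` {..<k - 1}" "c' \<notin> l ` {..<k - 1}" using left c(3,4) by force+
  then have "card (insert c (insert c' (l ` {..<k - 1}))) = k + 1"
    using ne inj k by (simp add: card_image)
  moreover have "insert c (insert c' (l ` {..<k - 1})) \<subseteq> N a b" using c l by auto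
  ultimately have "k + 1 \<le> card (N a b)" unfolding N_def by (metis List.finite_set card_mono)
  then show False using card_length[of "M ?x"] length_M[OF length_profile, of a b] by (simp add: N_def)
qed

text \<open>Either agent could join the other, where a coincident pair is served exactly, so each
  has a facility within \<open>b - a\<close>. Uniqueness identifies the two facilities, and both
  bounds together place it in \<open>[a, b]\<close>.\<close>

lemma facility_between:
  assumes "lo \<le> a" "a \<le> b" "b \<le> a + \<tau>"
  shows "\<exists>c\<in>N a b. a \<le> c \<and> c \<le> b"
proof -
  have sep: "separated \<gamma> a b" "separated \<gamma> b a" "separated \<gamma> a a" "separated \<gamma> b b"
    using assms \<tau> \<gamma> by (auto simp: separated_def)
  obtain c where c: "c \<in> N a b" "\<bar>b - c\<bar> \<le> \<bar>b - a\<bar>"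
    using N_strategyproof[of a b a] served_coincident[of a] assms sep by auto
  obtain c' where c': "c' \<in> N a b" "\<bar>a - c'\<bar> \<le> \<bar>a - b\<bar>"
    using N_strategyproof[of b a b] served_coincident[of b] assms sep N_sym[of a b] by auto
  have "c = c'" using assms c c' \<tau> by (intro unique_facility[of a b]) auto
  then show ?thesis using c c' assms by (intro bexI[of _ c]) auto
qed

text \<open>If \<open>z\<close> were unserved in both pairs, the facility of \<open>(a, b)\<close>
  would lie strictly on one side of \<open>z\<close>. The hole on that side lets an agent inside it
  obtain a facility outside the span of its own tiny pair, contradicting
  \<open>facility_between\<close> and uniqueness.\<close>

lemma served_alternates:
  assumes "lo \<le> a" "a < z" "z < b" "b \<le> a + \<tau>" and az: "z \<notin> N a z"
  shows "z \<in> N z b"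
proof (rule ccontr)
  assume bz: "z \<notin> N z b"
  have tau: "\<tau> < 1 / \<gamma>" by (rule \<tau>)
  obtain c where c: "c \<in> N a b" "a \<le> c" "c \<le> b" using facility_between[of a b] assms by auto
  \<comment> \<open>Otherwise an agent at \<open>z\<close> could obtain \<open>z\<close> next to
    \<open>a\<close> by reporting \<open>b\<close>, contrary to \<open>az\<close>.\<close>
  have ca: "c \<noteq> z"
    using N_strategyproof[of a z b] c az assms tau by (force simp: separated_def)
  show False
  proof (cases "z < c")
    case True
    obtain r where r: "z < r" "r \<le> c" and rN:
      "\<And>w. w \<in> {w. lo \<le> w \<and> separated \<gamma> a w} \<Longrightarrow> w \<le> r \<Longrightarrow> r - w < w - z \<Longrightarrow> r \<in> N a w"
      by (rule hole_right[of "{w. lo \<le> w \<and> separated \<gamma> a w}" "N a" z b c])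
        (use N_strategyproof assms tau c True in \<open>auto simp: separated_def\<close>)
    define w where "w = r - (r - z) / 3"
    have w: "z < w" "w < r" "r - w < w - z" using r by (auto simp: w_def field_simps)
    have "r \<in> N a w" using w r c assms tau by (intro rN) (auto simp: separated_def)
    moreover obtain d where "d \<in> N a w" "a \<le> d" "d \<le> w"
      using facility_between[of a w] assms w r c by auto
    ultimately show False using unique_facility[of a w r d] assms w r c by auto
  next
    case False
    obtain l where l: "l < z" "c \<le> l" and lN:
      "\<And>w. w \<in> {w. lo \<le> w \<and> separated \<gamma> b w} \<Longrightarrow> l \<le> w \<Longrightarrow> w - l < z - w \<Longrightarrow> l \<in> N b w"
      by (rule hole_left[of "{w. lo \<le> w \<and> separated \<gamma> b w}" "N b" z a c])
        (use N_strategyproof assms tau c ca bz False N_sym[of a b] N_sym[of z b] in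
          \<open>auto simp: separated_def\<close>)
    define w where "w = l + (z - l) / 3"
    have w: "w < z" "l < w" "w - l < z - w" using l by (auto simp: w_def field_simps)
    have "l \<in> N w b" using w l c assms tau N_sym[of w b] lN[of w] by (auto simp: separated_def)
    moreover obtain d where "d \<in> N w b" "w \<le> d" "d \<le> b"
      using facility_between[of w b] assms w l c by auto
    ultimately show False using unique_facility[of w b l d] assms w l c by auto
  qed
qed

text \<open>If \<open>z\<close> is unserved as a right agent, it is served as a left agent, and then
  its right partner is not. Widths of \<open>\<tau> / 2\<close> keep two adjoining pairs within
  \<open>\<tau>\<close>, and the property spreads to the right in such steps.\<close>

lemma right_agent_unserved:
  assumes "lo \<le> a0" "a0 < z0" "z0 \<le> a0 + \<tau> / 2" "z0 \<notin> N a0 z0"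
    and "z0 \<le> z" "z < b" "b \<le> z + \<tau> / 2"
  shows "b \<notin> N z b"
proof -
  have next_unserved: "y \<notin> N z y"
    if "lo \<le> a" "a < z" "z \<le> a + \<tau> / 2" "z \<notin> N a z" "z < y" "y \<le> z + \<tau> / 2" for a z y
  proof
    assume "y \<in> N z y"
    moreover have "z \<in> N z y" using that by (intro served_alternates[of a z y]) auto
    ultimately show False using unique_facility[of z y z y] that \<tau> by auto
  qed
  \<comment> \<open>The induction covers one interval of length \<open>\<tau> / 2\<close> at a time;
    every point of it is the unserved right agent of some tiny pair.\<close>
  have "\<forall>z. z0 + real i * (\<tau> / 2) \<le> z \<and> z \<le> z0 + real (Suc i) * (\<tau> / 2) \<longrightarrow>
      (\<exists>a\<ge>lo. a < z \<and> z \<le> a + \<tau> / 2 \<and> z \<notin> N a z)" for i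
  proof (induction i)
    case 0
    show ?case
    proof (intro allI impI)
      fix z assume "z0 + real 0 * (\<tau> / 2) \<le> z \<and> z \<le> z0 + real (Suc 0) * (\<tau> / 2)"
      then show "\<exists>a\<ge>lo. a < z \<and> z \<le> a + \<tau> / 2 \<and> z \<notin> N a z"
        using next_unserved[of a0 z0 z] assms(1-4)
        by (intro exI[of _ "if z = z0 then a0 else z0"]) auto
    qed
  next
    case (Suc i)
    show ?case
    proof (intro allI impI)
      fix z assume z: "z0 + real (Suc i) * (\<tau> / 2) \<le> z \<and> z \<le> z0 + real (Suc (Suc i)) * (\<tau> / 2)"
      \<comment> \<open>This shifts \<open>z\<close> into the preceding interval, where the
        induction hypothesis applies.\<close>
      define y where "y = z - \<tau> / 2"
      have "z0 + real i * (\<tau> / 2) \<le> y" "y \<le> z0 + real (Suc i) * (\<tau> / 2)"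
        using z by (auto simp: y_def field_simps)
      then obtain a where "lo \<le> a" "a < y" "y \<le> a + \<tau> / 2" "y \<notin> N a y" using Suc by blast
      then show "\<exists>a\<ge>lo. a < z \<and> z \<le> a + \<tau> / 2 \<and> z \<notin> N a z"
        using next_unserved[of a y z] \<tau> by (intro exI[of _ y]) (auto simp: y_def)
    qed
  qed
  moreover define i where "i = nat \<lfloor>(z - z0) / (\<tau> / 2)\<rfloor>"
  moreover have "real i \<le> (z - z0) / (\<tau> / 2)" "(z - z0) / (\<tau> / 2) \<le> real (Suc i)"
    using assms \<tau> unfolding i_def by (auto simp: of_nat_nat) linarith+
  then have "z0 + real i * (\<tau> / 2) \<le> z" "z \<le> z0 + real (Suc i) * (\<tau> / 2)"
    using \<tau> by (auto simp: field_simps)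
  ultimately obtain a where "lo \<le> a" "a < z" "z \<le> a + \<tau> / 2" "z \<notin> N a z" by blast
  then show ?thesis using next_unserved[of a z b] assms by auto
qed

text \<open>One unserved right agent leaves all right agents beyond it unserved, against
  \<open>right_agent_served\<close> started at \<open>z0\<close>. If there is none,
  \<open>left_agent_served\<close> yields a tiny pair with both agents served, against
  \<open>unique_facility\<close>.\<close>

lemma impossible: False
proof (cases "\<exists>a z. lo \<le> a \<and> a < z \<and> z \<le> a + \<tau> / 2 \<and> z \<notin> N a z")
  case True
  then obtain a0 z0 where z0: "lo \<le> a0" "a0 < z0" "z0 \<le> a0 + \<tau> / 2" "z0 \<notin> N a0 z0" by blast
  have "\<exists>a b. z0 \<le> a \<and> a < b \<and> b \<le> a + \<tau> / 2 \<and> b \<le> z0 + \<gamma> + 2 * \<rho> + \<tau> / 2 + 1 \<and> b \<in> N a b"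
    by (rule right_agent_served[OF \<gamma> _ _ N_sym, where \<rho> = \<rho>])
      (use N_strategyproof served_distant z0 \<rho> \<tau> in auto)
  then show False using right_agent_unserved[OF z0] by blast
next
  case False
  have "\<exists>a b. lo \<le> a \<and> a < b \<and> b \<le> a + \<tau> / 2 \<and> b \<le> lo + \<gamma> + 2 * \<rho> + \<tau> / 2 + 1 \<and> a \<in> N a b"
    by (rule left_agent_served[OF \<gamma> _ _ N_sym, where \<rho> = \<rho>])
      (use N_strategyproof served_distant \<rho> \<tau> in auto)
  then obtain a b where ab: "lo \<le> a" "a < b" "b \<le> a + \<tau> / 2" "a \<in> N a b" by blast
  then have "b \<in> N a b" using False by blast
  then show False using unique_facility[of a b a b] ab \<tau> by auto
qed

end

theorem theorem3:
  fixes k n :: nat and \<delta> :: real and M :: "real list \<Rightarrow> real list"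
  assumes "k \<ge> 3" and "\<delta> > 0" and "sqrt 2 - \<delta> \<ge> 1" and "n \<ge> k + 1"
    and "\<forall>x. length x = n \<longrightarrow> length (M x) = k"
    and "anonymous n M"
    and "strategyproof_stable n k (sqrt 2 - \<delta>) M"
  shows "\<not> (\<exists>\<rho>::real. \<forall>x. length x = n \<and> stable (sqrt 2 - \<delta>) k x \<longrightarrow>
              social_cost x (M x) \<le> \<rho> * opt_cost k x)"
proof
  assume "\<exists>\<rho>::real. \<forall>x. length x = n \<and> stable (sqrt 2 - \<delta>) k x \<longrightarrow>
              social_cost x (M x) \<le> \<rho> * opt_cost k x"
  then obtain \<rho> where \<rho>: "\<And>x. length x = n \<Longrightarrow> stable (sqrt 2 - \<delta>) k x \<Longrightarrow>
      social_cost x (M x) \<le> \<rho> * opt_cost k x" by blast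
  have n: "n - k + k = n" "0 < n - k" using assms(4) by auto
  have "(sqrt 2 - \<delta>) * (sqrt 2 - \<delta>) < sqrt 2 * sqrt 2"
    using assms(2,3) by (intro mult_strict_mono) auto
  then have sq: "(sqrt 2 - \<delta>) * (sqrt 2 - \<delta>) < 2" by simp
  \<comment> \<open>Nonnegativity of the optimum allows replacing \<open>\<rho>\<close> by
    \<open>max 1 \<rho>\<close>, as the locale requires a ratio of at least 1.\<close>
  have "0 \<le> opt_cost k x" for x
    unfolding opt_cost_def
  proof (rule cInf_greatest)
    show "{social_cost x c |c. length c = k} \<noteq> {}" using length_replicate[of k 0] by blast
    show "0 \<le> y" if "y \<in> {social_cost x c |c. length c = k}" for y
      using that assms(1) by (force intro: social_cost_nonneg)
  qed
  then have "\<rho> * opt_cost k x \<le> max 1 \<rho> * opt_cost k x" for x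
    by (intro mult_right_mono) auto
  then have "bounded_mechanism (n - k) k (sqrt 2 - \<delta>) (max 1 \<rho>) M"
    using assms n sq \<rho> by unfold_locales (simp_all add: order_trans[OF \<rho>])
  then show False by (rule bounded_mechanism.impossible)
qed

end
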